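(* Let $s \geq 1$ be an integer and, for $n \geq 0$, let $g(n)$ denote the number of linear extensions of the uneven type-$\alpha$ comb $\alpha^{\ast}_{s}(n)$ that avoid both patterns $312$ and $321$. Then $$g(n) = \begin{cases} 1 & \text{if } n \leq s,\\ 2^{n-s} & \text{if } s < n < 2s,\\ 2g(n-1) - g(n-s-1) & \text{if } n \geq 2s.\end{cases}$$
   Context: A linear extension of a finite poset $P$ on a set of integers is a listing $v=[v_1,\dots,v_n]$ of all elements of $P$, each exactly once, such that whenever $a \leq_P b$, $a$ appears before $b$. For $w \in S_3$, a sequence $v$ of distinct integers contains $w$ if there are indices $i<j<k$ with $(v_i,v_j,v_k)$ in the same relative order as $(w_1,w_2,w_3)$; otherwise $v$ avoids $w$. The uneven type-$\alpha$ comb $\alpha^{\ast}_{s}(n)$ with $s$ teeth and $n$ elements is the poset on $\{1,\dots,n\}$ whose order is generated by the relations $i \leq i+1$ for $1 \leq i < \min(s,n)$ (the spine) and $x \leq x+s$ for $1 \leq x \leq n-s$ (the teeth $c, c+s, c+2s, \dots$ for $1 \le c \le s$, truncated at $n$). When $n = ts$, this is the type-$\alpha$ comb with $s$ teeth of length $t$. *)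

theory Defs
  imports Main
begin

definition comb_generators :: "nat \<Rightarrow> nat \<Rightarrow> (nat \<times> nat) set" where
  "comb_generators s n =
     {(i, i + 1) | i. 1 \<le> i \<and> i < min s n} \<union> {(x, x + s) | x. 1 \<le> x \<and> x + s \<le> n}"

text \<open>The reflexive closure in \<^term>\<open>r\<^sup>*\<close> ranges over the whole type, so the order is
  restricted to its carrier.\<close>

definition comb_order :: "nat \<Rightarrow> nat \<Rightarrow> (nat \<times> nat) set" where
  "comb_order s n = (comb_generators s n)\<^sup>* \<inter> ({1..n} \<times> {1..n})"

text \<open>The order relation is reflexive, hence the weak inequality between positions.\<close>

definition linear_extension :: "'a set \<Rightarrow> ('a \<times> 'a) set \<Rightarrow> 'a list \<Rightarrow> bool" where
  "linear_extension A r v \<longleftrightarrow>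
     distinct v \<and> set v = A \<and>
     (\<forall>i < length v. \<forall>j < length v. (v ! i, v ! j) \<in> r \<longrightarrow> i \<le> j)"

definition same_relative_order :: "nat list \<Rightarrow> nat list \<Rightarrow> bool" where
  "same_relative_order u w \<longleftrightarrow>
     length u = length w \<and>
     (\<forall>p < length u. \<forall>q < length u. u ! p < u ! q \<longleftrightarrow> w ! p < w ! q)"

definition contains3 :: "nat list \<Rightarrow> nat list \<Rightarrow> bool" where
  "contains3 v w \<longleftrightarrow>
     (\<exists>i j k. i < j \<and> j < k \<and> k < length v \<and> same_relative_order [v ! i, v ! j, v ! k] w)"

definition avoids3 :: "nat list \<Rightarrow> nat list \<Rightarrow> bool" where
  "avoids3 v w \<longleftrightarrow> \<not> contains3 v w"

definition comb_avoiders :: "nat \<Rightarrow> nat \<Rightarrow> nat list set" where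
  "comb_avoiders s n =
     {v. linear_extension {1..n} (comb_order s n) v \<and> avoids3 v [3, 1, 2] \<and> avoids3 v [3, 2, 1]}"

definition g :: "nat \<Rightarrow> nat \<Rightarrow> nat" where
  "g s n = card (comb_avoiders s n)"

lemma comb_generators_less:
  assumes "s \<ge> 1" "(a, b) \<in> comb_generators s n"
  shows "a < b"
  using assms by (auto simp: comb_generators_def)

lemma comb_order_le:
  assumes "s \<ge> 1" "(a, b) \<in> comb_order s n"
  shows "a \<le> b"
proof -
  have "(a, b) \<in> (comb_generators s n)\<^sup>*"
    using assms(2) by (simp add: comb_order_def)
  then show ?thesis
    by induction (auto dest: comb_generators_less[OF assms(1)])
qed

lemma partial_order_on_comb_order:
  assumes "s \<ge> 1"
  shows "partial_order_on {1..n} (comb_order s n)"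
  unfolding partial_order_on_def preorder_on_def
proof (intro conjI)
  show "comb_order s n \<subseteq> {1..n} \<times> {1..n}"
    by (auto simp: comb_order_def)
  show "refl_on {1..n} (comb_order s n)"
    by (auto simp: refl_on_def comb_order_def)
  show "trans (comb_order s n)"
    by (auto simp: trans_def comb_order_def)
  show "antisym (comb_order s n)"
    using comb_order_le[OF assms] by (auto simp: antisym_def intro: order.antisym)
qed

lemma finite_comb_avoiders: "finite (comb_avoiders s n)"
proof (rule finite_subset)
  show "comb_avoiders s n \<subseteq> {v. set v \<subseteq> {1..n} \<and> length v = n}"
  proof
    fix v assume "v \<in> comb_avoiders s n"
    then have "distinct v" "set v = {1..n}"
      by (auto simp: comb_avoiders_def linear_extension_def)
    then show "v \<in> {v. set v \<subseteq> {1..n} \<and> length v = n}"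
      using distinct_card[of v] by simp
  qed
  show "finite {v. set v \<subseteq> {1..n} \<and> length v = n}"
    by (rule finite_lists_length_eq) simp
qed

end

theory Submission
  imports Defs
begin

text \<open>A permutation avoids 312 and 321 iff no entry has two smaller entries to its right. Hence the
  largest entry \<open>n\<close> is last or last but one, and deleting it leaves an avoider on
  \<open>{1..n-1}\<close>; conversely \<open>n\<close> can always be appended to an avoider \<open>w\<close>, and can be put just before
  its last entry \<open>x\<close> unless \<open>x\<close> lies below \<open>n\<close> in the poset. For \<open>n > s\<close> the latter happens only
  for \<open>x = n - s\<close>, because \<open>x\<close> is maximal in the smaller comb. Stripping the maximum repeatedly
  shows that the avoiders with last entry \<open>x\<close> are the words \<open>u, x+1, ..., n-1, x\<close> with \<open>u\<close> an avoider
  on \<open>{1..x-1}\<close>, provided \<open>x\<close> is below none of \<open>x+1, ..., n-1\<close>. So \<open>g(n-s-1)\<close> is subtracted from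
  \<open>2g(n-1)\<close> if \<open>n - s \<ge> s\<close>, and nothing is subtracted if \<open>0 < n - s < s\<close>.\<close>

section \<open>Simultaneous avoidance of 312 and 321 as a recursive condition\<close>

fun few_smaller_right :: "'a::linorder list \<Rightarrow> bool" where
  "few_smaller_right [] \<longleftrightarrow> True"
| "few_smaller_right (x # xs) \<longleftrightarrow>
     (\<forall>y\<in>set xs. \<forall>z\<in>set xs. y < x \<longrightarrow> z < x \<longrightarrow> y = z) \<and> few_smaller_right xs"

text \<open>The recursion compares values, so \<open>[3, 1, 1]\<close> passes it; distinctness turns
  equality of values into equality of positions.\<close>

lemma few_smaller_right_iff_nth:
  assumes "distinct v"
  shows "few_smaller_right v \<longleftrightarrow>
    (\<forall>i j k. i < j \<longrightarrow> j < k \<longrightarrow> k < length v \<longrightarrow> \<not> (v ! j < v ! i \<and> v ! k < v ! i))"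
  using assms
proof (induction v)
  case Nil
  then show ?case by simp
next
  case (Cons x xs)
  let ?P = "\<lambda>v. \<forall>i j k. i < j \<longrightarrow> j < k \<longrightarrow> k < length v \<longrightarrow> \<not> (v ! j < v ! i \<and> v ! k < v ! i)"
  have head: "(\<forall>y\<in>set xs. \<forall>z\<in>set xs. y < x \<longrightarrow> z < x \<longrightarrow> y = z) \<longleftrightarrow>
      (\<forall>j k. j < k \<longrightarrow> k < length xs \<longrightarrow> \<not> (xs ! j < x \<and> xs ! k < x))" (is "?L \<longleftrightarrow> ?R")
  proof
    assume L: ?L
    show ?R
    proof (intro allI impI notI)
      fix j k assume jk: "j < k" "k < length xs" "xs ! j < x \<and> xs ! k < x"
      then have "xs ! j = xs ! k" using L by (meson nth_mem order.strict_trans)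
      then show False using jk Cons.prems by (simp add: nth_eq_iff_index_eq)
    qed
  next
    assume R: ?R
    show ?L
    proof (intro ballI impI)
      fix y z assume "y \<in> set xs" "z \<in> set xs" "y < x" "z < x"
      moreover from this obtain j k where "j < length xs" "xs ! j = y" "k < length xs" "xs ! k = z"
        by (auto simp: in_set_conv_nth)
      ultimately show "y = z" using R by (metis linorder_neqE_nat)
    qed
  qed
  have "?P (x # xs) \<longleftrightarrow>
      (\<forall>j k. j < k \<longrightarrow> k < length xs \<longrightarrow> \<not> (xs ! j < x \<and> xs ! k < x)) \<and> ?P xs" (is "?L \<longleftrightarrow> ?R")
  proof
    assume L: ?L
    have "\<not> (xs ! j < x \<and> xs ! k < x)" if "j < k" "k < length xs" for j k
      using L[rule_format, of 0 "Suc j" "Suc k"] that by simp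
    moreover have "\<not> (xs ! j < xs ! i \<and> xs ! k < xs ! i)"
      if "i < j" "j < k" "k < length xs" for i j k
      using L[rule_format, of "Suc i" "Suc j" "Suc k"] that by simp
    ultimately show ?R by blast
  next
    assume R: ?R
    show ?L
    proof (intro allI impI)
      fix i j k assume ijk: "i < j" "j < k" "k < length (x # xs)"
      then obtain j' k' where jk: "j = Suc j'" "k = Suc k'" by (cases j; cases k) auto
      show "\<not> ((x # xs) ! j < (x # xs) ! i \<and> (x # xs) ! k < (x # xs) ! i)"
      proof (cases i)
        case 0
        then show ?thesis using R ijk jk by simp
      next
        case (Suc i')
        then show ?thesis using R[THEN conjunct2, rule_format, of i' j' k'] ijk jk by simp
      qed
    qed
  qed
  then show ?case using head Cons by simp
qed

lemma same_relative_order_312: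
  "same_relative_order [a, b, c] [3, 1, 2] \<longleftrightarrow> b < c \<and> c < a"
  unfolding same_relative_order_def by (auto simp: less_Suc_eq numeral_3_eq_3 numeral_2_eq_2)

lemma same_relative_order_321:
  "same_relative_order [a, b, c] [3, 2, 1] \<longleftrightarrow> c < b \<and> b < a"
  unfolding same_relative_order_def by (auto simp: less_Suc_eq numeral_3_eq_3 numeral_2_eq_2)

text \<open>Two smaller entries to the right of some entry form 312 with it if they increase and 321
  if they decrease; by distinctness there is no third case.\<close>

lemma avoids_312_321_iff:
  assumes "distinct v"
  shows "avoids3 v [3, 1, 2] \<and> avoids3 v [3, 2, 1] \<longleftrightarrow> few_smaller_right v"
proof -
  have "v ! j < v ! k \<or> v ! k < v ! j" if "j < k" "k < length v" for j k
    using that assms by (simp add: nth_eq_iff_index_eq neq_iff[symmetric])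
  then have "(v ! j < v ! k \<and> v ! k < v ! i) \<or> (v ! k < v ! j \<and> v ! j < v ! i) \<longleftrightarrow>
      v ! j < v ! i \<and> v ! k < v ! i" if "j < k" "k < length v" for i j k
    using that order.strict_trans by blast
  then show ?thesis
    unfolding few_smaller_right_iff_nth[OF assms] avoids3_def contains3_def
      same_relative_order_312 same_relative_order_321
    by blast
qed

lemma few_smaller_right_snoc_max:
  assumes "\<forall>x\<in>set u. x < m"
  shows "few_smaller_right (u @ [m]) \<longleftrightarrow> few_smaller_right u"
  using assms by (induction u) auto

text \<open>The new \<open>m\<close> has only \<open>x\<close> to its right, and it is never a
  smaller entry for anything in \<open>u\<close>.\<close>

lemma few_smaller_right_insert_max:
  assumes "\<forall>x\<in>set u. x < m"
  shows "few_smaller_right (u @ [m, x]) \<longleftrightarrow> few_smaller_right (u @ [x])"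
  using assms
proof (induction u)
  case (Cons a u)
  then have "\<not> m < a" by (simp add: less_imp_not_less)
  then have "(\<forall>y\<in>set (u @ [m, x]). \<forall>z\<in>set (u @ [m, x]). y < a \<longrightarrow> z < a \<longrightarrow> y = z) \<longleftrightarrow>
      (\<forall>y\<in>set (u @ [x]). \<forall>z\<in>set (u @ [x]). y < a \<longrightarrow> z < a \<longrightarrow> y = z)"
    by (simp add: ball_Un)
  then show ?case using Cons by simp
qed simp

lemma few_smaller_right_appendD: "few_smaller_right (u @ v) \<Longrightarrow> few_smaller_right v"
  by (induction u) auto

section \<open>Avoiders for an arbitrary relation: insertion of the largest entry\<close>

definition avoiders :: "(nat \<times> nat) set \<Rightarrow> nat \<Rightarrow> nat list set" where
  "avoiders r n = {v. distinct v \<and> set v = {1..n} \<and> sorted_wrt (\<lambda>x y. (y, x) \<notin> r) v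
     \<and> few_smaller_right v}"

lemma finite_avoiders: "finite (avoiders r n)"
proof (rule finite_subset)
  show "avoiders r n \<subseteq> {v. set v \<subseteq> {1..n} \<and> length v = n}"
  proof
    fix v assume "v \<in> avoiders r n"
    then show "v \<in> {v. set v \<subseteq> {1..n} \<and> length v = n}"
      using distinct_card[of v] by (simp add: avoiders_def)
  qed
qed (simp add: finite_lists_length_eq)

lemma avoiders_0: "avoiders r 0 = {[]}"
  by (auto simp: avoiders_def)

lemma avoiders_nonempty: "w \<in> avoiders r n \<Longrightarrow> 1 \<le> n \<Longrightarrow> w \<noteq> []"
  by (auto simp: avoiders_def)

lemma avoiders_last_mem: "w \<in> avoiders r n \<Longrightarrow> 1 \<le> n \<Longrightarrow> last w \<in> {1..n}"
  using avoiders_nonempty last_in_set by (fastforce simp: avoiders_def)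

text \<open>Every other element stands before the last entry, so none of them can lie above it in
  \<open>r\<close>.\<close>

lemma avoiders_last_maximal:
  assumes "w \<in> avoiders r n" "(last w, y) \<in> r" "y \<in> {1..n}"
  shows "y = last w"
proof -
  have y: "y \<in> set w" using assms by (simp add: avoiders_def)
  then obtain u x where w: "w = u @ [x]" by (cases w rule: rev_cases) auto
  have "sorted_wrt (\<lambda>x y. (y, x) \<notin> r) (u @ [x])"
    using assms(1) w by (simp add: avoiders_def)
  then have "y \<notin> set u" using assms(2) w by (auto simp: sorted_wrt_append)
  then show ?thesis using y w by simp
qed

definition insert_before_last :: "'a \<Rightarrow> 'a list \<Rightarrow> 'a list" where
  "insert_before_last m w = butlast w @ [m, last w]"

text \<open>The empty list has to be excluded: it has the same \<open>butlast\<close> and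
  \<open>last\<close> as \<open>[last []]\<close>, hence the same image.\<close>

lemma inj_on_insert_before_last:
  assumes "[] \<notin> A"
  shows "inj_on (insert_before_last m) A"
proof (rule inj_onI)
  fix v w assume "v \<in> A" "w \<in> A" "insert_before_last m v = insert_before_last m w"
  then have "butlast v = butlast w" "last v = last w" "v \<noteq> []" "w \<noteq> []"
    using assms by (auto simp: insert_before_last_def)
  then show "v = w" by (metis append_butlast_last_id)
qed

lemma last_insert_before_last: "last (insert_before_last m w) = last w"
  by (simp add: insert_before_last_def)

lemma insert_Suc_eq_atLeastAtMost_iff:
  "Suc n \<notin> A \<and> insert (Suc n) A = {1..Suc n} \<longleftrightarrow> A = {1..n}"
proof -
  have "{1..Suc n} = insert (Suc n) {1..n}" by auto
  then show ?thesis by (metis Suc_n_not_le_n atLeastAtMost_iff insert_ident)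
qed

text \<open>As \<open>r\<close> refines the numerical order, \<open>Suc n\<close> lies below no
  entry of \<open>u\<close> and may safely follow all of them.\<close>

lemma append_max_avoiders:
  assumes "r \<subseteq> {(a, b). a \<le> b}"
  shows "u @ [Suc n] \<in> avoiders r (Suc n) \<longleftrightarrow> u \<in> avoiders r n"
proof -
  have set_eq: "distinct (u @ [Suc n]) \<and> set (u @ [Suc n]) = {1..Suc n} \<longleftrightarrow>
      distinct u \<and> set u = {1..n}"
    using insert_Suc_eq_atLeastAtMost_iff[of n "set u"] by auto
  have "sorted_wrt (\<lambda>x y. (y, x) \<notin> r) (u @ [Suc n]) \<longleftrightarrow> sorted_wrt (\<lambda>x y. (y, x) \<notin> r) u"
    if "set u = {1..n}"
    using that assms by (force simp: sorted_wrt_append)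
  then show ?thesis
    using set_eq few_smaller_right_snoc_max[of u "Suc n"] by (auto simp: avoiders_def)
qed

text \<open>The only new order constraint that can fail concerns the pair \<open>Suc n\<close>,
  \<open>x\<close>, since \<open>x\<close> is the only entry placed after
  \<open>Suc n\<close>.\<close>

lemma insert_max_avoiders:
  assumes "r \<subseteq> {(a, b). a \<le> b}"
  shows "u @ [Suc n, x] \<in> avoiders r (Suc n) \<longleftrightarrow> u @ [x] \<in> avoiders r n \<and> (x, Suc n) \<notin> r"
proof -
  have set_eq: "distinct (u @ [Suc n, x]) \<and> set (u @ [Suc n, x]) = {1..Suc n} \<longleftrightarrow>
      distinct (u @ [x]) \<and> set (u @ [x]) = {1..n}"
    using insert_Suc_eq_atLeastAtMost_iff[of n "set (u @ [x])"] by (auto simp: insert_commute)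
  have "sorted_wrt (\<lambda>x y. (y, x) \<notin> r) (u @ [Suc n, x]) \<longleftrightarrow>
      sorted_wrt (\<lambda>x y. (y, x) \<notin> r) (u @ [x]) \<and> (x, Suc n) \<notin> r"
    if "set (u @ [x]) = {1..n}"
  proof -
    have "(Suc n, a) \<notin> r" if "a \<in> set u" for a
    proof -
      have "a \<in> {1..n}" using that \<open>set (u @ [x]) = {1..n}\<close> by auto
      then show ?thesis using assms by auto
    qed
    then show ?thesis by (auto simp: sorted_wrt_append)
  qed
  moreover have "few_smaller_right (u @ [Suc n, x]) \<longleftrightarrow> few_smaller_right (u @ [x])"
    if "set (u @ [x]) = {1..n}"
  proof (rule few_smaller_right_insert_max)
    have "set u \<subseteq> {1..n}" using that by auto
    then show "\<forall>a\<in>set u. a < Suc n" by auto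
  qed
  ultimately show ?thesis
    using set_eq unfolding avoiders_def mem_Collect_eq by blast
qed

text \<open>Everything to the right of \<open>Suc n\<close> is smaller than it, so at most one entry
  can stand there.\<close>

lemma avoiders_max_cases:
  assumes "v \<in> avoiders r (Suc n)"
  obtains u where "v = u @ [Suc n]" | u x where "v = u @ [Suc n, x]"
proof -
  have v: "distinct v" "set v = {1..Suc n}" "few_smaller_right v"
    using assms by (auto simp: avoiders_def)
  then have "Suc n \<in> set v" by simp
  then obtain u rest where split: "v = u @ Suc n # rest"
    by (meson split_list)
  have "\<forall>y\<in>set rest. y < Suc n"
  proof
    fix y assume "y \<in> set rest"
    then have "y \<in> set v" "y \<noteq> Suc n" using v(1) split by auto
    then show "y < Suc n" using v(2) by auto
  qed
  moreover have "few_smaller_right (Suc n # rest)"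
    using v(3) split few_smaller_right_appendD by blast
  ultimately have eq: "y = z" if "y \<in> set rest" "z \<in> set rest" for y z
    using that by auto
  show thesis
  proof (cases rest)
    case Nil
    then show thesis using split that(1) by simp
  next
    case (Cons x rest')
    have "rest' = []"
    proof (cases rest')
      case (Cons y zs)
      then have "x = y" using eq[of x y] \<open>rest = x # rest'\<close> by simp
      then show ?thesis using v(1) split Cons \<open>rest = x # rest'\<close> by simp
    qed simp
    then show thesis using split Cons that(2) by simp
  qed
qed

lemma avoiders_Suc:
  assumes "r \<subseteq> {(a, b). a \<le> b}"
  shows "avoiders r (Suc n) = (\<lambda>u. u @ [Suc n]) ` avoiders r n \<union>
    insert_before_last (Suc n) ` {w \<in> avoiders r n. w \<noteq> [] \<and> (last w, Suc n) \<notin> r}"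
proof (intro equalityI subsetI)
  fix v assume v: "v \<in> avoiders r (Suc n)"
  from v show "v \<in> (\<lambda>u. u @ [Suc n]) ` avoiders r n \<union>
    insert_before_last (Suc n) ` {w \<in> avoiders r n. w \<noteq> [] \<and> (last w, Suc n) \<notin> r}"
  proof (cases rule: avoiders_max_cases)
    case (1 u)
    then show ?thesis using v append_max_avoiders[OF assms] by auto
  next
    case (2 u x)
    then have "u @ [x] \<in> avoiders r n" "(x, Suc n) \<notin> r" "v = insert_before_last (Suc n) (u @ [x])"
      using v insert_max_avoiders[OF assms] by (auto simp: insert_before_last_def)
    then show ?thesis by (intro UnI2 image_eqI[of _ _ "u @ [x]"]) auto
  qed
next
  fix v assume "v \<in> (\<lambda>u. u @ [Suc n]) ` avoiders r n \<union>
    insert_before_last (Suc n) ` {w \<in> avoiders r n. w \<noteq> [] \<and> (last w, Suc n) \<notin> r}"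
  then show "v \<in> avoiders r (Suc n)"
    by (auto simp: insert_before_last_def append_max_avoiders[OF assms] insert_max_avoiders[OF assms])
qed

lemma card_avoiders_Suc:
  assumes "r \<subseteq> {(a, b). a \<le> b}"
  shows "card (avoiders r (Suc n)) = card (avoiders r n) +
    card {w \<in> avoiders r n. w \<noteq> [] \<and> (last w, Suc n) \<notin> r}"
proof -
  let ?B = "{w \<in> avoiders r n. w \<noteq> [] \<and> (last w, Suc n) \<notin> r}"
  \<comment> \<open>The last entry separates the two images: an appended \<open>Suc n\<close> is
    last, whereas insertion before the last entry keeps a last entry of at most
    \<open>n\<close>.\<close>
  have "last w \<noteq> Suc n" if "w \<in> ?B" for w
  proof -
    have "last w \<in> {1..n}" using that last_in_set[of w] by (simp add: avoiders_def)
    then show ?thesis by auto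
  qed
  then have "last v \<noteq> Suc n" if "v \<in> insert_before_last (Suc n) ` ?B" for v
    using that by (auto simp: last_insert_before_last)
  moreover have "last v = Suc n" if "v \<in> (\<lambda>u. u @ [Suc n]) ` avoiders r n" for v
    using that by auto
  ultimately have "(\<lambda>u. u @ [Suc n]) ` avoiders r n \<inter> insert_before_last (Suc n) ` ?B = {}"
    by blast
  moreover have "card ((\<lambda>u. u @ [Suc n]) ` avoiders r n) = card (avoiders r n)"
    by (rule card_image) (simp add: inj_on_def)
  moreover have "card (insert_before_last (Suc n) ` ?B) = card ?B"
    by (rule card_image, rule inj_on_insert_before_last) simp
  ultimately show ?thesis
    unfolding avoiders_Suc[OF assms] by (simp add: card_Un_disjoint finite_avoiders)
qed

text \<open>Induction on the number \<open>j\<close> of values above \<open>Suc x\<close>. For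
  \<open>j = 0\<close> the entry \<open>Suc x\<close> is the maximum, and deleting it is a
  bijection. Each further maximum has to go just before \<open>Suc x\<close>, which is possible in
  exactly one way unless \<open>r\<close> forbids it.\<close>

lemma card_avoiders_last:
  assumes "r \<subseteq> {(a, b). a \<le> b}"
  shows "card {w \<in> avoiders r (Suc x + j). last w = Suc x} =
    (if \<exists>m\<in>{Suc x<..Suc x + j}. (Suc x, m) \<in> r then 0 else card (avoiders r x))"
proof (induction j)
  case 0
  have "{w \<in> avoiders r (Suc x). last w = Suc x} = (\<lambda>u. u @ [Suc x]) ` avoiders r x"
  proof (intro equalityI subsetI)
    fix w assume "w \<in> {w \<in> avoiders r (Suc x). last w = Suc x}"
    then have w: "w \<in> avoiders r (Suc x)" "last w = Suc x" by auto
    then have "butlast w @ [Suc x] = w"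
      using avoiders_nonempty[OF w(1)] append_butlast_last_id[of w] by simp
    then show "w \<in> (\<lambda>u. u @ [Suc x]) ` avoiders r x"
      using w(1) append_max_avoiders[OF assms, of "butlast w" x] by (metis image_eqI)
  qed (auto simp: append_max_avoiders[OF assms])
  moreover have "card ((\<lambda>u. u @ [Suc x]) ` avoiders r x) = card (avoiders r x)"
    by (rule card_image) (simp add: inj_on_def)
  ultimately show ?case by simp
next
  case (Suc j)
  let ?m = "Suc x + j"
  let ?L = "{w \<in> avoiders r ?m. last w = Suc x}"
  have L: "[] \<notin> ?L" using avoiders_nonempty[of "[]" r ?m] by auto
  have eq: "{w \<in> avoiders r (Suc ?m). last w = Suc x} =
      insert_before_last (Suc ?m) ` {w \<in> ?L. (Suc x, Suc ?m) \<notin> r}"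
  proof (intro equalityI subsetI)
    fix v assume "v \<in> {w \<in> avoiders r (Suc ?m). last w = Suc x}"
    then show "v \<in> insert_before_last (Suc ?m) ` {w \<in> ?L. (Suc x, Suc ?m) \<notin> r}"
      unfolding avoiders_Suc[OF assms] by (auto simp: last_insert_before_last)
  next
    fix v assume "v \<in> insert_before_last (Suc ?m) ` {w \<in> ?L. (Suc x, Suc ?m) \<notin> r}"
    then obtain w where w: "v = insert_before_last (Suc ?m) w" "w \<in> ?L" "(Suc x, Suc ?m) \<notin> r"
      by blast
    then have "w \<noteq> []" using L by blast
    then show "v \<in> {w \<in> avoiders r (Suc ?m). last w = Suc x}"
      unfolding avoiders_Suc[OF assms] using w by (simp add: last_insert_before_last)
  qed
  \<comment> \<open>The condition on \<open>(Suc x, Suc ?m)\<close> does not depend on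
    \<open>w\<close>, so it keeps either all of \<open>?L\<close> or nothing.\<close>
  have "card {w \<in> avoiders r (Suc ?m). last w = Suc x} = (if (Suc x, Suc ?m) \<in> r then 0 else card ?L)"
    unfolding eq using card_image[OF inj_on_insert_before_last[OF L]] by simp
  moreover have "{Suc x<..Suc x + Suc j} = insert (Suc ?m) {Suc x<..?m}" by auto
  ultimately show ?case using Suc.IH by simp
qed

section \<open>The infinite comb, one fixed relation that serves for all \<open>n\<close>\<close>

definition comb_steps :: "nat \<Rightarrow> (nat \<times> nat) set" where
  "comb_steps s = {(i, i + 1) | i. 1 \<le> i \<and> i < s} \<union> {(x, x + s) | x. 1 \<le> x}"

lemma comb_steps_rtrancl_le: "(a, b) \<in> (comb_steps s)\<^sup>* \<Longrightarrow> a \<le> b"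
  by (induction rule: rtrancl_induct) (auto simp: comb_steps_def)

lemma comb_steps_rtrancl_subset: "(comb_steps s)\<^sup>* \<subseteq> {(a, b). a \<le> b}"
  using comb_steps_rtrancl_le by auto

text \<open>Steps only increase, so a path ending at or below \<open>n\<close> never exceeds
  \<open>n\<close>, and all its steps survive the truncation.\<close>

lemma comb_order_eq: "comb_order s n = (comb_steps s)\<^sup>* \<inter> ({1..n} \<times> {1..n})"
proof -
  have "(comb_generators s n)\<^sup>* \<subseteq> (comb_steps s)\<^sup>*"
    by (rule rtrancl_mono) (auto simp: comb_generators_def comb_steps_def)
  moreover have "b \<le> n \<longrightarrow> (a, b) \<in> (comb_generators s n)\<^sup>*" if "(a, b) \<in> (comb_steps s)\<^sup>*" for a b
    using that
  proof (induction rule: rtrancl_induct)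
    case (step y z)
    show ?case
    proof
      assume "z \<le> n"
      moreover from this have "(y, z) \<in> comb_generators s n"
        using step.hyps(2) by (auto simp: comb_steps_def comb_generators_def)
      moreover have "y \<le> z" using step.hyps(2) by (auto simp: comb_steps_def)
      ultimately show "(a, z) \<in> (comb_generators s n)\<^sup>*"
        using step.IH by (auto intro: rtrancl.rtrancl_into_rtrancl)
    qed
  qed simp
  ultimately show ?thesis by (auto simp: comb_order_def)
qed

lemma comb_avoiders_eq: "comb_avoiders s n = avoiders ((comb_steps s)\<^sup>*) n"
proof -
  have lin: "linear_extension {1..n} (comb_order s n) v \<longleftrightarrow>
      distinct v \<and> set v = {1..n} \<and> sorted_wrt (\<lambda>x y. (y, x) \<notin> (comb_steps s)\<^sup>*) v" for v
  proof -
    have "(v ! i, v ! j) \<in> comb_order s n \<longleftrightarrow> (v ! i, v ! j) \<in> (comb_steps s)\<^sup>*"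
      if "set v = {1..n}" "i < length v" "j < length v" for i j
      using that nth_mem by (fastforce simp: comb_order_eq)
    then show ?thesis
      unfolding linear_extension_def sorted_wrt_iff_nth_less
      by (meson linorder_not_le order.strict_trans)
  qed
  show ?thesis
    unfolding comb_avoiders_def avoiders_def
  proof (rule Collect_cong)
    fix v
    show "linear_extension {1..n} (comb_order s n) v \<and> avoids3 v [3, 1, 2] \<and> avoids3 v [3, 2, 1]
      \<longleftrightarrow> distinct v \<and> set v = {1..n} \<and> sorted_wrt (\<lambda>x y. (y, x) \<notin> (comb_steps s)\<^sup>*) v
        \<and> few_smaller_right v"
      using lin[of v] avoids_312_321_iff[of v] by argo
  qed
qed

lemma g_eq: "g s n = card (avoiders ((comb_steps s)\<^sup>*) n)"
  by (simp add: g_def comb_avoiders_eq)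

lemma comb_spine_chain:
  assumes "1 \<le> a" "a \<le> b" "b \<le> s"
  shows "(a, b) \<in> (comb_steps s)\<^sup>*"
  using assms(2,3)
proof (induction b rule: dec_induct)
  case (step m)
  have "(m, Suc m) \<in> comb_steps s" using step assms(1) by (auto simp: comb_steps_def)
  then show ?case using step by (simp add: rtrancl.rtrancl_into_rtrancl)
qed simp

text \<open>Spine steps start below \<open>s\<close>, and paths never descend, so a path starting at
  \<open>s\<close> or above consists of tooth steps only.\<close>

lemma comb_tooth_dvd:
  assumes "(a, b) \<in> (comb_steps s)\<^sup>*" "s \<le> a"
  shows "s dvd b - a"
  using assms(1)
proof (induction rule: rtrancl_induct)
  case (step y z)
  have "a \<le> y" using step.hyps(1) by (rule comb_steps_rtrancl_le)
  then have "z = y + s" using step.hyps(2) assms(2) by (auto simp: comb_steps_def)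
  then have "z - a = (y - a) + s" using \<open>a \<le> y\<close> by simp
  then show ?case using step.IH by simp
qed simp

section \<open>Initial values and recurrence\<close>

lemma g_chain:
  assumes "n \<le> s"
  shows "g s n = 1"
  using assms
proof (induction n)
  case 0
  then show ?case by (simp add: g_eq avoiders_0)
next
  case (Suc n)
  \<comment> \<open>Up to \<open>s\<close> the comb is a chain, so every possible last entry lies
    below \<open>Suc n\<close> and only appending remains.\<close>
  have "(last w, Suc n) \<in> (comb_steps s)\<^sup>*" if "w \<in> avoiders ((comb_steps s)\<^sup>*) n" "w \<noteq> []" for w
  proof -
    have "last w \<in> {1..n}" using that last_in_set[of w] by (simp add: avoiders_def)
    then show ?thesis using Suc.prems by (intro comb_spine_chain) auto
  qed
  then have none: "{w \<in> avoiders ((comb_steps s)\<^sup>*) n. w \<noteq> [] \<and> (last w, Suc n) \<notin> (comb_steps s)\<^sup>*} = {}"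
    by blast
  show ?case
    using card_avoiders_Suc[of "(comb_steps s)\<^sup>*" n, OF comb_steps_rtrancl_subset] Suc
    unfolding none g_eq by simp
qed

text \<open>The first step of a path from \<open>last w\<close> leaves \<open>{1..n}\<close> because
  \<open>last w\<close> is maximal there, so it leads directly to \<open>Suc n\<close>. As spine
  steps end at or below \<open>s \<le> n\<close>, it is a tooth step.\<close>

lemma avoiders_last_below_new_iff:
  assumes "1 \<le> s" "s \<le> n" "w \<in> avoiders ((comb_steps s)\<^sup>*) n"
  shows "(last w, Suc n) \<in> (comb_steps s)\<^sup>* \<longleftrightarrow> last w = Suc n - s"
proof
  have last: "last w \<in> {1..n}" using avoiders_last_mem assms by simp
  assume "(last w, Suc n) \<in> (comb_steps s)\<^sup>*"
  then obtain y where y: "(last w, y) \<in> comb_steps s" "(y, Suc n) \<in> (comb_steps s)\<^sup>*"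
    using last by (auto elim: converse_rtranclE)
  have less: "last w < y" using y(1) assms(1) by (auto simp: comb_steps_def)
  have "\<not> y \<le> n"
    using avoiders_last_maximal[OF assms(3), of y] y(1) less by auto
  then have "y = Suc n" using comb_steps_rtrancl_le[OF y(2)] by simp
  then show "last w = Suc n - s" using y(1) assms(2) by (auto simp: comb_steps_def)
next
  assume "last w = Suc n - s"
  then have "(last w, Suc n) \<in> comb_steps s" using assms(2) by (auto simp: comb_steps_def)
  then show "(last w, Suc n) \<in> (comb_steps s)\<^sup>*" by blast
qed

text \<open>Only avoiders ending in \<open>Suc n - s\<close> refuse the second insertion. The sum
  form avoids truncated subtraction.\<close>

lemma g_Suc:
  assumes "1 \<le> s" "s \<le> n"
  shows "g s (Suc n) + card {w \<in> avoiders ((comb_steps s)\<^sup>*) n. last w = Suc n - s} = 2 * g s n"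
proof -
  let ?r = "(comb_steps s)\<^sup>*"
  let ?A = "{w \<in> avoiders ?r n. w \<noteq> [] \<and> (last w, Suc n) \<notin> ?r}"
  let ?B = "{w \<in> avoiders ?r n. last w = Suc n - s}"
  have "w \<noteq> []" if "w \<in> avoiders ?r n" for w
    using avoiders_nonempty[OF that] assms by linarith
  then have split: "avoiders ?r n = ?A \<union> ?B" "?A \<inter> ?B = {}"
    using avoiders_last_below_new_iff[OF assms] by blast+
  have "card (?A \<union> ?B) = card ?A + card ?B"
    using finite_avoiders[of ?r n] split(2) by (intro card_Un_disjoint) simp_all
  then have "card (avoiders ?r n) = card ?A + card ?B"
    using arg_cong[OF split(1), of card] by (rule trans[rotated])
  then show ?thesis
    using card_avoiders_Suc[of ?r n, OF comb_steps_rtrancl_subset] unfolding g_eq by simp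
qed

text \<open>Only \<open>s - 1\<close> values lie between \<open>Suc (n - s)\<close> and the new
  maximum, too few for a tooth step. An obstruction must therefore come from the spine, which means
  \<open>Suc (n - s) < s\<close>.\<close>

lemma card_comb_avoiders_last:
  assumes "1 \<le> s" "s \<le> n"
  shows "card {w \<in> avoiders ((comb_steps s)\<^sup>*) n. last w = Suc n - s} =
    (if Suc n < 2 * s then 0 else g s (n - s))"
proof -
  let ?r = "(comb_steps s)\<^sup>*"
  have n: "Suc (n - s) + (s - 1) = n" "Suc n - s = Suc (n - s)" using assms by auto
  have "(\<exists>m\<in>{Suc (n - s)<..n}. (Suc (n - s), m) \<in> ?r) \<longleftrightarrow> Suc n < 2 * s"
  proof
    assume "\<exists>m\<in>{Suc (n - s)<..n}. (Suc (n - s), m) \<in> ?r"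
    then obtain m where m: "Suc (n - s) < m" "m \<le> n" "(Suc (n - s), m) \<in> ?r" by auto
    \<comment> \<open>The difference is positive and less than \<open>s\<close>, so by
      \<open>comb_tooth_dvd\<close> the path must start below \<open>s\<close>.\<close>
    have "\<not> s dvd m - Suc (n - s)"
      using m by (intro nat_dvd_not_less) auto
    then show "Suc n < 2 * s" using comb_tooth_dvd[OF m(3)] by linarith
  next
    assume "Suc n < 2 * s"
    then have "(Suc (n - s), Suc (Suc (n - s))) \<in> ?r"
      using assms by (intro comb_spine_chain) auto
    \<comment> \<open>The upper bound needs \<open>s \<ge> 2\<close>, which follows from
      \<open>s \<le> n\<close> and \<open>Suc n < 2 * s\<close>.\<close>
    moreover have "Suc (Suc (n - s)) \<in> {Suc (n - s)<..n}"
      using \<open>Suc n < 2 * s\<close> assms by auto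
    ultimately show "\<exists>m\<in>{Suc (n - s)<..n}. (Suc (n - s), m) \<in> ?r" by blast
  qed
  then show ?thesis
    using card_avoiders_last[of ?r "n - s" "s - 1", OF comb_steps_rtrancl_subset] n
    unfolding g_eq by simp
qed

text \<open>In this range the subtracted term vanishes, so the count doubles at each step from
  \<open>g s s = 1\<close>.\<close>

lemma g_powers_of_two:
  assumes "1 \<le> s" "s + k < 2 * s"
  shows "g s (s + k) = 2 ^ k"
  using assms(2)
proof (induction k)
  case 0
  then show ?case by (simp add: g_chain)
next
  case (Suc k)
  then show ?case
    using g_Suc[of s "s + k"] card_comb_avoiders_last[of s "s + k"] assms(1) by simp
qed

theorem theorem16:
  fixes s n :: nat
  assumes "s \<ge> 1"
  shows "int (g s n) =
    (if n \<le> s then 1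
     else if n < 2 * s then 2 ^ (n - s)
     else 2 * int (g s (n - 1)) - int (g s (n - s - 1)))"
proof -
  consider "n \<le> s" | "s < n" "n < 2 * s" | "s < n" "2 * s \<le> n" by linarith
  then show ?thesis
  proof cases
    case 1
    then show ?thesis by (simp add: g_chain)
  next
    case 2
    then show ?thesis using g_powers_of_two[of s "n - s"] assms by simp
  next
    case 3
    then obtain m where m: "n = Suc m" "s \<le> m" by (metis Suc_le_mono Suc_leI Suc_le_D)
    \<comment> \<open>Here \<open>m - s\<close> is \<open>n - s - 1\<close>, and
      \<open>2 * s \<le> n\<close> selects the nonzero branch of
      \<open>card_comb_avoiders_last\<close>.\<close>
    then have "g s (Suc m) + g s (m - s) = 2 * g s m"
      using g_Suc[OF assms m(2)] card_comb_avoiders_last[OF assms m(2)] 3 by simp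
    then show ?thesis using m 3 by (simp add: diff_right_commute)
  qed
qed

end
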